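(* Let $\mathcal{A}$ be a unital Banach algebra with unit $1$ and let $a\in\mathcal{A}$ and $b,c\in\mathcal{A}^\dag$ be such that $a$ is $(b,c)$-invertible and $a^{-(b,c)}\neq0$. Suppose that $(a_n)_{n\in\mathbb{N}}\subset\mathcal{A}$ and $(b_n)_{n\in\mathbb{N}},(c_n)_{n\in\mathbb{N}}\subset\mathcal{A}^\dag$ are sequences such that $a_n$ is $(b_n,c_n)$-invertible for each $n\in\mathbb{N}$. If $(a_n)_{n\in\mathbb{N}}$ converges to $a$, then the following statements are equivalent (limits as $n\to\infty$). (i) $a_n^{-(b_n,c_n)}\to a^{-(b,c)}$. (ii) $a_n^{-(b_n,c_n)}a_n\to a^{-(b,c)}a$, $c^\dag c(1-c_n^\dag c_n)\to0$ and $c_n^\dag c_n(1-c^\dag c)\to0$. (iii) $a_na_n^{-(b_n,c_n)}\to aa^{-(b,c)}$, $(1-bb^\dag)b_nb_n^\dag\to0$ and $(1-b_nb_n^\dag)bb^\dag\to0$. (iv) $(1-bb^\dag)b_nb_n^\dag\to0$, $(1-b_nb_n^\dag)bb^\dag\to0$, $c^\dag c(1-c_n^\dag c_n)\to0$ and $c_n^\dag c_n(1-c^\dag c)\to0$. (v) $a_na_n^{-(b_n,c_n)}\to aa^{-(b,c)}$, $bb^\dag(1-b_nb_n^\dag)\to0$ and $b_nb_n^\dag(1-bb^\dag)\to0$. (vi) $a_n^{-(b_n,c_n)}a_n\to a^{-(b,c)}a$, $(1-c^\dag c)c_n^\dag c_n\to0$ and $(1-c_n^\dag c_n)c^\dag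 c\to0$. (vii) $bb^\dag(1-b_nb_n^\dag)\to0$, $b_nb_n^\dag(1-bb^\dag)\to0$, $(1-c^\dag c)c_n^\dag c_n\to0$ and $(1-c_n^\dag c_n)c^\dag c\to0$. (viii) $b_nb_n^\dag\to bb^\dag$ and $c_n^\dag c_n\to c^\dag c$.
   Context: The unit of $\mathcal{A}$ has norm one. For $b,c\in\mathcal{A}$, $a\in\mathcal{A}$ is $(b,c)$-invertible if there exists $y\in\mathcal{A}$ such that $y\in (b\mathcal{A}y)\cap(y\mathcal{A}c)$, $b=yab$ and $c=cay$; such $y$ is unique when it exists and is denoted $a^{-(b,c)}$. An element $z\in\mathcal{A}$ is hermitian if $\|\exp(itz)\|=1$ for all $t\in\mathbb{R}$. An element $x\in\mathcal{A}$ is Moore-Penrose invertible if there is $y\in\mathcal{A}$ with $x=xyx$, $y=yxy$ and $xy$, $yx$ hermitian; such $y$ is unique when it exists and is denoted $x^\dag$. $\mathcal{A}^\dag$ is the set of Moore-Penrose invertible elements of $\mathcal{A}$. *)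

theory Defs
  imports "HOL-Analysis.Analysis"
begin

text \<open>
  The distribution has no type class of complex normed algebras. This class extends a real unital
  Banach algebra (where \<open>norm 1 = 1\<close>, and where \<^const>\<open>exp\<close> is defined) by a complex scalar
  multiplication that restricts to the real one.
\<close>

class complex_banach_algebra_1 = real_normed_algebra_1 + banach +
  fixes scaleC :: "complex \<Rightarrow> 'a \<Rightarrow> 'a"  (infixr \<open>*\<^sub>C\<close> 75)
  assumes scaleR_scaleC: "r *\<^sub>R x = complex_of_real r *\<^sub>C x"
    and scaleC_add_right: "z *\<^sub>C (x + y) = z *\<^sub>C x + z *\<^sub>C y"
    and scaleC_add_left: "(z + w) *\<^sub>C x = z *\<^sub>C x + w *\<^sub>C x"
    and scaleC_scaleC: "z *\<^sub>C w *\<^sub>C x = (z * w) *\<^sub>C x"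
    and mult_scaleC_left: "(z *\<^sub>C x) * y = z *\<^sub>C (x * y)"
    and mult_scaleC_right: "x * (z *\<^sub>C y) = z *\<^sub>C (x * y)"
    and norm_scaleC: "norm (z *\<^sub>C x) = cmod z * norm x"

instantiation complex :: complex_banach_algebra_1
begin

definition scaleC_complex :: "complex \<Rightarrow> complex \<Rightarrow> complex" where
  "scaleC_complex z x = z * x"

instance
  by standard (simp_all add: scaleC_complex_def algebra_simps scaleR_conv_of_real norm_mult)

end

definition hermitian :: "'a::complex_banach_algebra_1 \<Rightarrow> bool" where
  "hermitian z \<longleftrightarrow> (\<forall>t::real. norm (exp ((\<i> * complex_of_real t) *\<^sub>C z)) = 1)"

definition is_mp_inverse :: "'a::complex_banach_algebra_1 \<Rightarrow> 'a \<Rightarrow> bool" where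
  "is_mp_inverse x y \<longleftrightarrow>
    x = x * y * x \<and> y = y * x * y \<and> hermitian (x * y) \<and> hermitian (y * x)"

definition mp_invertible :: "'a::complex_banach_algebra_1 \<Rightarrow> bool" where
  "mp_invertible x \<longleftrightarrow> (\<exists>y. is_mp_inverse x y)"

definition mp_inverse :: "'a::complex_banach_algebra_1 \<Rightarrow> 'a"  (\<open>_\<^sup>\<dagger>\<close> [1000] 999) where
  "x\<^sup>\<dagger> = (THE y. is_mp_inverse x y)"

definition is_bc_inverse :: "'a::ring_1 \<Rightarrow> 'a \<Rightarrow> 'a \<Rightarrow> 'a \<Rightarrow> bool" where
  "is_bc_inverse b c a y \<longleftrightarrow>
    y \<in> {b * x * y | x. True} \<inter> {y * x * c | x. True} \<and> b = y * a * b \<and> c = c * a * y"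

definition bc_invertible :: "'a::ring_1 \<Rightarrow> 'a \<Rightarrow> 'a \<Rightarrow> bool" where
  "bc_invertible b c a \<longleftrightarrow> (\<exists>y. is_bc_inverse b c a y)"

definition bc_inverse :: "'a::ring_1 \<Rightarrow> 'a \<Rightarrow> 'a \<Rightarrow> 'a" where
  "bc_inverse b c a = (THE y. is_bc_inverse b c a y)"

lemma is_bc_inverse_unique:
  assumes y: "is_bc_inverse b c a y" and z: "is_bc_inverse b c a z"
  shows "y = z"
proof -
  from y obtain u where u: "y = b * u * y" by (auto simp: is_bc_inverse_def)
  from z obtain v where v: "z = z * v * c" by (auto simp: is_bc_inverse_def)
  have "z * a * y = (z * a * b) * u * y"
    using u by (metis mult.assoc)
  also have "\<dots> = y"
    using z u by (simp add: is_bc_inverse_def)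
  finally have 1: "z * a * y = y" .
  have "z * a * y = z * v * (c * a * y)"
    using v by (metis mult.assoc)
  also have "\<dots> = z"
    using y v by (simp add: is_bc_inverse_def)
  finally show ?thesis using 1 by simp
qed

end

theory Submission
  imports Defs
begin

text \<open>
  Put \<open>y = a\<^bsup>-(b,c)\<^esup>\<close>, \<open>p = bb\<^sup>\<dagger>\<close>, \<open>q = c\<^sup>\<dagger>c\<close>, and similarly with index \<open>n\<close>. Every condition reduces to
  \<open>p\<^sub>n \<longlonglongrightarrow> p\<close> and \<open>q\<^sub>n \<longlonglongrightarrow> q\<close>. The key point is that, for hermitian idempotents, one-sided closeness
  (\<open>(1-p)p\<^sub>n \<longlonglongrightarrow> 0\<close> and \<open>(1-p\<^sub>n)p \<longlonglongrightarrow> 0\<close>) forces \<open>p\<^sub>n \<longlonglongrightarrow> p\<close>. Indeed the symmetry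
  \<open>1 - 2p = exp(i\<pi>p)\<close> has norm one, so \<open>u\<^sub>n = (1-2p)(1-2p\<^sub>n)\<close> is a contraction, and up to a null sequence
  \<open>u\<^sub>n = 1 - 2h\<^sub>n\<close> with \<open>h\<^sub>n = p - p\<^sub>n\<close> and \<open>h\<^sub>n\<^sup>2 \<longlonglongrightarrow> 0\<close>. Hence \<open>u\<^sub>n\<^sup>m\<close> is asymptotically \<open>1 - 2mh\<^sub>n\<close>,
  and its norm being at most one gives \<open>limsup \<parallel>h\<^sub>n\<parallel> \<le> 1/m\<close> for every \<open>m\<close>. The idempotents \<open>ya\<close> and \<open>p\<close>
  have the same right ideal, and \<open>ay\<close> and \<open>q\<close> the same left ideal, so convergence of \<open>y\<^sub>na\<^sub>n\<close> or
  \<open>a\<^sub>ny\<^sub>n\<close> gives one-sided closeness; conversely \<open>y\<^sub>n(1 - e\<^sub>n) = y + d\<^sub>n\<close> with null sequences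
  \<open>e\<^sub>n\<close>, \<open>d\<^sub>n\<close> built from \<open>a\<^sub>n - a\<close>, \<open>p\<^sub>n - p\<close> and \<open>q\<^sub>n - q\<close>.
\<close>

section \<open>Exponentials and norms of hermitian idempotents\<close>

lemma bounded_linear_scaleC_left:
  "bounded_linear (\<lambda>z. z *\<^sub>C (x::'a::complex_banach_algebra_1))"
proof (rule bounded_linear_intro[where K = "norm x"])
  fix z w :: complex and r :: real
  show "(z + w) *\<^sub>C x = z *\<^sub>C x + w *\<^sub>C x" by (rule scaleC_add_left)
  show "(r *\<^sub>R z) *\<^sub>C x = r *\<^sub>R z *\<^sub>C x"
    by (simp only: scaleR_scaleC[of r "z *\<^sub>C x"] scaleR_conv_of_real[of r z] scaleC_scaleC)
  show "norm (z *\<^sub>C x) \<le> norm z * norm x" by (simp add: norm_scaleC)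
qed

lemma power_scaleC_idempotent:
  fixes p :: "'a::complex_banach_algebra_1"
  assumes "p * p = p"
  shows "(z *\<^sub>C p) ^ Suc n = z ^ Suc n *\<^sub>C p"
proof (induction n)
  case (Suc n)
  then show ?case
    using assms by (subst power_Suc) (simp add: mult_scaleC_left mult_scaleC_right scaleC_scaleC mult_ac)
qed simp

text \<open>All positive powers of an idempotent coincide, so after its constant term the
  exponential series is the scalar series of \<open>exp z - 1\<close> multiplied by
  \<open>p\<close>.\<close>

lemma exp_scaleC_idempotent:
  fixes p :: "'a::complex_banach_algebra_1"
  assumes "p * p = p"
  shows "exp (z *\<^sub>C p) = 1 + (exp z - 1) *\<^sub>C p"
proof -
  have "(\<lambda>n. z ^ Suc n /\<^sub>R fact (Suc n)) sums (exp z - 1)"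
    using exp_converges[of z] by (subst sums_Suc_iff) simp
  then have "(\<lambda>n. (z ^ Suc n /\<^sub>R fact (Suc n)) *\<^sub>C p) sums ((exp z - 1) *\<^sub>C p)"
    by (rule bounded_linear.sums[OF bounded_linear_scaleC_left])
  moreover have "(z ^ Suc n /\<^sub>R fact (Suc n)) *\<^sub>C p = (z *\<^sub>C p) ^ Suc n /\<^sub>R fact (Suc n)" for n
    unfolding power_scaleC_idempotent[OF assms]
    by (rule linear_cmul[OF bounded_linear.linear[OF bounded_linear_scaleC_left]])
  ultimately have "(\<lambda>n. (z *\<^sub>C p) ^ Suc n /\<^sub>R fact (Suc n)) sums ((exp z - 1) *\<^sub>C p)"
    by simp
  then have "(\<lambda>n. (z *\<^sub>C p) ^ n /\<^sub>R fact n) sums ((exp z - 1) *\<^sub>C p + 1)"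
    by (subst (asm) sums_Suc_iff) simp
  then show ?thesis
    using exp_converges sums_unique2 by (metis add.commute)
qed

lemma norm_one_minus_twice_hermitian_idempotent:
  fixes p :: "'a::complex_banach_algebra_1"
  assumes "hermitian p" "p * p = p"
  shows "norm (1 - 2 * p) = 1"
proof -
  have "exp ((\<i> * complex_of_real pi) *\<^sub>C p) = 1 + (-2) *\<^sub>C p"
    using exp_scaleC_idempotent[OF assms(2), of "\<i> * complex_of_real pi"]
    by (simp add: exp_pi_i' exp_pi_i mult.commute)
  also have "(-2) *\<^sub>C p = - 2 * p"
    using scaleR_scaleC[of "-2" p] by (simp add: scaleR_conv_of_real)
  finally show ?thesis
    using assms(1) by (simp add: hermitian_def) (metis)
qed

lemma norm_hermitian_idempotent_le_1:
  fixes p :: "'a::complex_banach_algebra_1"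
  assumes "hermitian p" "p * p = p"
  shows "norm p \<le> 1"
proof -
  have "2 * norm p = norm (1 - (1 - 2 * p))"
    using norm_scaleR[of 2 p] by (simp add: scaleR_conv_of_real)
  also have "\<dots> \<le> 2"
    using norm_triangle_ineq4[of 1 "1 - 2 * p"] norm_one_minus_twice_hermitian_idempotent[OF assms]
    by simp
  finally show ?thesis by simp
qed

section \<open>Null sequences and powers of contractions\<close>

lemma tendsto_zero_mult_Bfun:
  fixes X Y :: "nat \<Rightarrow> 'a::real_normed_algebra"
  assumes "X \<longlonglongrightarrow> 0" "\<And>n. norm (Y n) \<le> K"
  shows "(\<lambda>n. X n * Y n) \<longlonglongrightarrow> 0" "(\<lambda>n. Y n * X n) \<longlonglongrightarrow> 0"
proof -
  have X: "Zfun X sequentially"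
    using assms(1) by (simp add: tendsto_Zfun_iff)
  have Y: "Bfun Y sequentially"
    using assms(2) by (intro BfunI[of _ K]) simp
  show "(\<lambda>n. X n * Y n) \<longlonglongrightarrow> 0" "(\<lambda>n. Y n * X n) \<longlonglongrightarrow> 0"
    using bounded_bilinear.Zfun_prod_Bfun[OF bounded_bilinear_mult X Y]
      bounded_bilinear.Bfun_prod_Zfun[OF bounded_bilinear_mult Y X]
    by (simp_all add: tendsto_Zfun_iff)
qed

lemma tendsto_zero_of_contractions:
  fixes h u :: "nat \<Rightarrow> 'a::real_normed_algebra_1"
  assumes u: "\<And>n. norm (u n) \<le> 1" and h: "\<And>n. norm (h n) \<le> K"
    and uh: "(\<lambda>n. u n - (1 - 2 * h n)) \<longlonglongrightarrow> 0" and h2: "(\<lambda>n. h n * h n) \<longlonglongrightarrow> 0"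
  shows "h \<longlonglongrightarrow> 0"
proof -
  have powers: "(\<lambda>n. u n ^ m - (1 - (2 * real m) *\<^sub>R h n)) \<longlonglongrightarrow> 0" for m
  proof (induction m)
    case (Suc m)
    have "norm (1 - (2 * real m) *\<^sub>R h n) \<le> 1 + 2 * real m * K" for n
    proof -
      have "norm (1 - (2 * real m) *\<^sub>R h n) \<le> 1 + norm ((2 * real m) *\<^sub>R h n)"
        by (metis norm_one norm_triangle_ineq4)
      also have "\<dots> \<le> 1 + 2 * real m * K"
        using h[of n] by (simp add: mult_left_mono)
      finally show ?thesis .
    qed
    \<comment> \<open>The first two terms replace \<open>u n ^ m\<close> and then \<open>u n\<close>
      by their approximants; the third is the quadratic term left by the product of these
      approximants. The bound just shown makes the second term null.\<close>
    then have "(\<lambda>n. (u n ^ m - (1 - (2 * real m) *\<^sub>R h n)) * u n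
        + (1 - (2 * real m) *\<^sub>R h n) * (u n - (1 - 2 * h n))
        + (4 * real m) *\<^sub>R (h n * h n)) \<longlonglongrightarrow> 0 + 0 + (4 * real m) *\<^sub>R 0"
      by (intro tendsto_add tendsto_scaleR tendsto_const h2
          tendsto_zero_mult_Bfun[OF Suc.IH u] tendsto_zero_mult_Bfun[OF uh])
    moreover have "(u n ^ m - (1 - (2 * real m) *\<^sub>R h n)) * u n
        + (1 - (2 * real m) *\<^sub>R h n) * (u n - (1 - 2 * h n))
        + (4 * real m) *\<^sub>R (h n * h n) = u n ^ Suc m - (1 - (2 * real (Suc m)) *\<^sub>R h n)" for n
    proof -
      have [simp]: "2 * x = 2 *\<^sub>R x" for x :: 'a
        by (simp add: scaleR_conv_of_real)
      have "u n ^ Suc m = u n ^ m * u n"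
        by (simp add: power_commutes)
      then show ?thesis
        by (simp add: algebra_simps)
    qed
    ultimately show ?case by simp
  qed simp
  show ?thesis
  proof (rule LIMSEQ_I)
    fix r :: real
    assume "0 < r"
    \<comment> \<open>The estimate below gives \<open>norm (h n) < 3 / (2 * m)\<close>: an error
      below 1 plus \<open>norm (1 - u n ^ m) \<le> 2\<close>. Any \<open>m > 2 / r\<close> brings
      this below \<open>r\<close>.\<close>
    then obtain m :: nat where m: "2 / r < real m" "m > 0"
      by (metis reals_Archimedean2 divide_pos_pos of_nat_0_less_iff order_less_trans zero_less_numeral)
    from LIMSEQ_D[OF powers[of m], of 1] obtain N
      where N: "\<And>n. n \<ge> N \<Longrightarrow> norm (u n ^ m - (1 - (2 * real m) *\<^sub>R h n)) < 1"
      by auto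
    have "norm (h n) < r" if "n \<ge> N" for n
    proof -
      have "(2 * real m) *\<^sub>R h n = (u n ^ m - (1 - (2 * real m) *\<^sub>R h n)) + (1 - u n ^ m)"
        by simp
      then have "2 * real m * norm (h n)
          \<le> norm (u n ^ m - (1 - (2 * real m) *\<^sub>R h n)) + norm (1 - u n ^ m)"
        by (metis norm_triangle_ineq norm_scaleR abs_of_nonneg of_nat_0_le_iff mult_nonneg_nonneg
            zero_le_numeral)
      moreover have "norm (1 - u n ^ m) \<le> 2"
      proof -
        have "norm (u n ^ m) \<le> 1"
          using norm_power_ineq[of "u n" m] power_le_one[OF norm_ge_zero u[of n], of m] by linarith
        then show ?thesis
          using norm_triangle_ineq4[of 1 "u n ^ m"] by simp
      qed
      ultimately have "2 * real m * norm (h n) < 3"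
        using N[OF that] by linarith
      moreover have "2 < real m * r"
        using m \<open>0 < r\<close> by (simp add: field_simps)
      ultimately have "real m * norm (h n) < real m * r"
        by linarith
      then show ?thesis
        using m by simp
    qed
    then show "\<exists>N. \<forall>n\<ge>N. norm (h n - 0) < r"
      by auto
  qed
qed

section \<open>Convergence of sequences of hermitian idempotents\<close>

locale hermitian_idempotents =
  fixes p :: "'a::complex_banach_algebra_1" and pn :: "nat \<Rightarrow> 'a"
  assumes herm: "hermitian p" "\<And>n. hermitian (pn n)"
    and idem: "p * p = p" "\<And>n. pn n * pn n = pn n"
begin

lemma norm_le: "norm p \<le> 1" "norm (pn n) \<le> 1"
  using norm_hermitian_idempotent_le_1 herm idem by auto

lemma norm_diff_le: "norm (p - pn n) \<le> 2" "norm (pn n - p) \<le> 2"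
  using norm_triangle_ineq4[of p "pn n"] norm_le(1) norm_le(2)[of n] norm_minus_commute[of p "pn n"]
  by linarith+

lemma norm_complement_le: "norm (1 - pn n) \<le> 2"
  using norm_triangle_ineq4[of 1 "pn n"] norm_le(2)[of n] by simp

lemma norm_symmetries_le: "norm ((1 - 2 * p) * (1 - 2 * pn n)) \<le> 1"
proof -
  have "norm (1 - 2 * p) = 1" "norm (1 - 2 * pn n) = 1"
    using norm_one_minus_twice_hermitian_idempotent herm idem by auto
  then show ?thesis
    using norm_mult_ineq[of "1 - 2 * p" "1 - 2 * pn n"] by simp
qed

lemma tendsto_if_left:
  assumes "(\<lambda>n. (1 - p) * pn n) \<longlonglongrightarrow> 0" "(\<lambda>n. (1 - pn n) * p) \<longlonglongrightarrow> 0"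
  shows "pn \<longlonglongrightarrow> p"
proof -
  \<comment> \<open>Numerals are expanded into sums so that \<open>algebra_simps\<close> can compare
    the noncommutative products.\<close>
  have 2: "2 * x = x + x" "x * 2 = x + x" "4 * x = x + x + x + x" for x :: 'a
    using distrib_right[of 1 1 x] distrib_left[of x 1 1] distrib_right[of 2 2 x] by simp_all
  have "(\<lambda>n. - 4 *\<^sub>R ((1 - p) * pn n)) \<longlonglongrightarrow> - 4 *\<^sub>R 0"
    by (intro tendsto_intros assms)
  moreover have "- 4 *\<^sub>R ((1 - p) * pn n)
      = (1 - 2 * p) * (1 - 2 * pn n) - (1 - 2 * (p - pn n))" for n
    by (simp add: scaleR_conv_of_real algebra_simps 2)
  ultimately have u: "(\<lambda>n. (1 - 2 * p) * (1 - 2 * pn n) - (1 - 2 * (p - pn n))) \<longlonglongrightarrow> 0"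
    by simp
  have "(p - pn n) * (p - pn n) = (1 - p) * pn n + (1 - pn n) * p" for n
    by (simp add: algebra_simps idem)
  then have "(\<lambda>n. (p - pn n) * (p - pn n)) \<longlonglongrightarrow> 0"
    using tendsto_add[OF assms] by simp
  from tendsto_zero_of_contractions[OF norm_symmetries_le norm_diff_le(1) u this]
  have "(\<lambda>n. p - (p - pn n)) \<longlonglongrightarrow> p - 0"
    by (intro tendsto_intros)
  then show ?thesis by simp
qed

lemma tendsto_if_right:
  assumes "(\<lambda>n. p * (1 - pn n)) \<longlonglongrightarrow> 0" "(\<lambda>n. pn n * (1 - p)) \<longlonglongrightarrow> 0"
  shows "pn \<longlonglongrightarrow> p"
proof -
  have 2: "2 * x = x + x" "x * 2 = x + x" "4 * x = x + x + x + x" for x :: 'a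
    using distrib_right[of 1 1 x] distrib_left[of x 1 1] distrib_right[of 2 2 x] by simp_all
  have "(\<lambda>n. - 4 *\<^sub>R (p * (1 - pn n))) \<longlonglongrightarrow> - 4 *\<^sub>R 0"
    by (intro tendsto_intros assms)
  \<comment> \<open>The side of the hypotheses dictates the sign of the difference: with
    \<open>pn n - p\<close> the defect is a multiple of \<open>p * (1 - pn n)\<close>, with
    \<open>p - pn n\<close> it is one of \<open>(1 - p) * pn n\<close>.\<close>
  moreover have "- 4 *\<^sub>R (p * (1 - pn n))
      = (1 - 2 * p) * (1 - 2 * pn n) - (1 - 2 * (pn n - p))" for n
    by (simp add: scaleR_conv_of_real algebra_simps 2)
  ultimately have u: "(\<lambda>n. (1 - 2 * p) * (1 - 2 * pn n) - (1 - 2 * (pn n - p))) \<longlonglongrightarrow> 0"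
    by simp
  have "(pn n - p) * (pn n - p) = p * (1 - pn n) + pn n * (1 - p)" for n
    by (simp add: algebra_simps idem)
  then have "(\<lambda>n. (pn n - p) * (pn n - p)) \<longlonglongrightarrow> 0"
    using tendsto_add[OF assms] by simp
  from tendsto_zero_of_contractions[OF norm_symmetries_le norm_diff_le(2) u this]
  have "(\<lambda>n. (pn n - p) + p) \<longlonglongrightarrow> 0 + p"
    by (intro tendsto_intros)
  then show ?thesis by simp
qed

lemma tendsto_iff_left:
  "pn \<longlonglongrightarrow> p \<longleftrightarrow> (\<lambda>n. (1 - p) * pn n) \<longlonglongrightarrow> 0 \<and> (\<lambda>n. (1 - pn n) * p) \<longlonglongrightarrow> 0"
proof
  assume "pn \<longlonglongrightarrow> p"
  then have "(\<lambda>n. (1 - p) * pn n) \<longlonglongrightarrow> (1 - p) * p" "(\<lambda>n. (1 - pn n) * p) \<longlonglongrightarrow> (1 - p) * p"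
    by (auto intro!: tendsto_intros)
  then show "(\<lambda>n. (1 - p) * pn n) \<longlonglongrightarrow> 0 \<and> (\<lambda>n. (1 - pn n) * p) \<longlonglongrightarrow> 0"
    by (simp add: left_diff_distrib idem)
qed (use tendsto_if_left in blast)

lemma tendsto_iff_right:
  "pn \<longlonglongrightarrow> p \<longleftrightarrow> (\<lambda>n. p * (1 - pn n)) \<longlonglongrightarrow> 0 \<and> (\<lambda>n. pn n * (1 - p)) \<longlonglongrightarrow> 0"
proof
  assume "pn \<longlonglongrightarrow> p"
  then have "(\<lambda>n. p * (1 - pn n)) \<longlonglongrightarrow> p * (1 - p)" "(\<lambda>n. pn n * (1 - p)) \<longlonglongrightarrow> p * (1 - p)"
    by (auto intro!: tendsto_intros)
  then show "(\<lambda>n. p * (1 - pn n)) \<longlonglongrightarrow> 0 \<and> (\<lambda>n. pn n * (1 - p)) \<longlonglongrightarrow> 0"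
    by (simp add: right_diff_distrib idem)
qed (use tendsto_if_right in blast)

text \<open>Since \<open>(1 - p) * f = 0\<close> and \<open>fn n * pn n = pn n\<close>, multiplying
  \<open>fn n - f\<close> by \<open>1 - p\<close> and \<open>pn n\<close> leaves
  \<open>(1 - p) * pn n\<close>; symmetrically for \<open>(1 - pn n) * p\<close>. The outer factors
  are bounded uniformly in \<open>n\<close>, so both products are null.\<close>

lemma tendsto_if_same_right_ideals:
  assumes "p * f = f" "f * p = p" "\<And>n. pn n * fn n = fn n" "\<And>n. fn n * pn n = pn n" "fn \<longlonglongrightarrow> f"
  shows "pn \<longlonglongrightarrow> p"
proof (rule tendsto_if_left)
  have d: "(\<lambda>n. fn n - f) \<longlonglongrightarrow> 0"
    using assms(5) by (rule LIM_zero)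
  have "(\<lambda>n. (1 - p) * ((fn n - f) * pn n)) \<longlonglongrightarrow> (1 - p) * 0"
    by (intro tendsto_intros tendsto_zero_mult_Bfun[OF d norm_le(2)])
  moreover have "(1 - p) * ((fn n - f) * pn n) = (1 - p) * pn n" for n
    using assms(1,4) by (simp add: algebra_simps flip: mult.assoc)
  ultimately show "(\<lambda>n. (1 - p) * pn n) \<longlonglongrightarrow> 0" by simp
  have "(\<lambda>n. ((1 - pn n) * (fn n - f)) * - p) \<longlonglongrightarrow> 0 * - p"
    by (intro tendsto_mult tendsto_const tendsto_zero_mult_Bfun[OF d norm_complement_le])
  moreover have "((1 - pn n) * (fn n - f)) * - p = (1 - pn n) * p" for n
    using assms(2,3) by (simp add: algebra_simps)
  ultimately show "(\<lambda>n. (1 - pn n) * p) \<longlonglongrightarrow> 0" by simp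
qed

text \<open>The mirror image, with \<open>g * (1 - p) = 0\<close> and
  \<open>pn n * gn n = pn n\<close>.\<close>

lemma tendsto_if_same_left_ideals:
  assumes "p * g = p" "g * p = g" "\<And>n. pn n * gn n = pn n" "\<And>n. gn n * pn n = gn n" "gn \<longlonglongrightarrow> g"
  shows "pn \<longlonglongrightarrow> p"
proof (rule tendsto_if_right)
  have d: "(\<lambda>n. gn n - g) \<longlonglongrightarrow> 0"
    using assms(5) by (rule LIM_zero)
  have "(\<lambda>n. - p * ((gn n - g) * (1 - pn n))) \<longlonglongrightarrow> - p * 0"
    by (intro tendsto_mult tendsto_const tendsto_zero_mult_Bfun[OF d norm_complement_le])
  moreover have "- p * ((gn n - g) * (1 - pn n)) = p * (1 - pn n)" for n
    using assms(1,4) by (simp add: algebra_simps flip: mult.assoc)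
  ultimately show "(\<lambda>n. p * (1 - pn n)) \<longlonglongrightarrow> 0" by simp
  have "(\<lambda>n. (pn n * (gn n - g)) * (1 - p)) \<longlonglongrightarrow> 0 * (1 - p)"
    by (intro tendsto_mult tendsto_const tendsto_zero_mult_Bfun[OF d norm_le(2)])
  moreover have "(pn n * (gn n - g)) * (1 - p) = pn n * (1 - p)" for n
    using assms(2,3) by (simp add: algebra_simps)
  ultimately show "(\<lambda>n. pn n * (1 - p)) \<longlonglongrightarrow> 0" by simp
qed

end

text \<open>Rigidity is the convergence criterion applied to constant sequences.\<close>

lemma hermitian_idempotent_eqI:
  fixes p q :: "'a::complex_banach_algebra_1"
  assumes "hermitian p" "hermitian q" "p * p = p" "q * q = q"
    and "p * q = q \<and> q * p = p \<or> p * q = p \<and> q * p = q"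
  shows "p = q"
proof -
  interpret hermitian_idempotents p "\<lambda>_. q"
    using assms by unfold_locales
  have "(\<lambda>_::nat. q) \<longlonglongrightarrow> p"
    using assms(5)
  proof
    assume "p * q = q \<and> q * p = p"
    then show ?thesis unfolding tendsto_iff_left by (simp add: left_diff_distrib)
  next
    assume "p * q = p \<and> q * p = q"
    then show ?thesis unfolding tendsto_iff_right by (simp add: right_diff_distrib)
  qed
  then show ?thesis
    by (simp add: LIMSEQ_const_iff)
qed

section \<open>Moore-Penrose inverses and their projections\<close>

lemma is_mp_inverse_unique:
  assumes y: "is_mp_inverse x y" and z: "is_mp_inverse x z"
  shows "y = z"
proof -
  have x: "x * y * x = x" "x * z * x = x" and yz: "y * x * y = y" "z * x * z = z"
    and herm: "hermitian (x * y)" "hermitian (x * z)" "hermitian (y * x)" "hermitian (z * x)"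
    using y z by (auto simp: is_mp_inverse_def)
  \<comment> \<open>Both products generate the right ideal of \<open>x\<close>; below,
    \<open>y * x\<close> and \<open>z * x\<close> both generate its left ideal.\<close>
  have "x * y = x * z"
    by (rule hermitian_idempotent_eqI) (use herm x in \<open>simp_all flip: mult.assoc\<close>)
  moreover have "y * x = z * x"
    by (rule hermitian_idempotent_eqI) (use herm x in \<open>simp_all add: mult.assoc\<close>)
  \<comment> \<open>\<open>y = y * x * y = z * x * y = z * x * z = z\<close>.\<close>
  ultimately show ?thesis
    using yz by (metis mult.assoc)
qed

lemma is_mp_inverse_mp_inverse:
  assumes "mp_invertible x"
  shows "is_mp_inverse x (x\<^sup>\<dagger>)"
  unfolding mp_inverse_def
  using assms is_mp_inverse_unique by (metis mp_invertible_def theI)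

lemma mp_inverse_projections:
  assumes "mp_invertible x"
  shows "x * x\<^sup>\<dagger> * x = x"
    and "hermitian (x * x\<^sup>\<dagger>)" "x * x\<^sup>\<dagger> * (x * x\<^sup>\<dagger>) = x * x\<^sup>\<dagger>"
    and "hermitian (x\<^sup>\<dagger> * x)" "x\<^sup>\<dagger> * x * (x\<^sup>\<dagger> * x) = x\<^sup>\<dagger> * x"
  using is_mp_inverse_mp_inverse[OF assms]
  by (auto simp: is_mp_inverse_def simp flip: mult.assoc)

section \<open>Identities and perturbation of the (b,c)-inverse\<close>

lemma is_bc_inverse_bc_inverse:
  assumes "bc_invertible b c a"
  shows "is_bc_inverse b c a (bc_inverse b c a)"
  unfolding bc_inverse_def
  using assms is_bc_inverse_unique by (metis bc_invertible_def theI)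

text \<open>\<open>y\<close> factors through \<open>b\<close> on the left and through
  \<open>c\<close> on the right, where the two projections act as identities. The last two equations
  are \<open>b = y * a * b\<close> and \<open>c = c * a * y\<close> multiplied by the Moore-Penrose
  inverses.\<close>

lemma bc_inverse_absorb:
  assumes "mp_invertible b" "mp_invertible c" "bc_invertible b c a"
  defines "y \<equiv> bc_inverse b c a"
  shows "b * b\<^sup>\<dagger> * y = y" "y * (c\<^sup>\<dagger> * c) = y"
    and "y * a * (b * b\<^sup>\<dagger>) = b * b\<^sup>\<dagger>" "c\<^sup>\<dagger> * c * (a * y) = c\<^sup>\<dagger> * c"
proof -
  note b = mp_inverse_projections(1)[OF assms(1)]
  note c = mp_inverse_projections(1)[OF assms(2)]
  obtain u v where u: "y = b * u * y" and v: "y = y * v * c"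
    and yab: "b = y * a * b" and cay: "c = c * a * y"
    using is_bc_inverse_bc_inverse[OF assms(3)] by (auto simp: y_def is_bc_inverse_def)
  show "b * b\<^sup>\<dagger> * y = y"
    using b u by (metis mult.assoc)
  show "y * (c\<^sup>\<dagger> * c) = y"
    using c v by (metis mult.assoc)
  show "y * a * (b * b\<^sup>\<dagger>) = b * b\<^sup>\<dagger>"
    using yab by (metis mult.assoc)
  show "c\<^sup>\<dagger> * c * (a * y) = c\<^sup>\<dagger> * c"
    using cay by (metis mult.assoc)
qed

text \<open>Boundedness of \<open>y\<close> is derived, not assumed: once
  \<open>norm (e n) < 1/2\<close> and \<open>norm (d n) < 1\<close>, the term
  \<open>y n * e n\<close> is absorbed into half of \<open>norm (y n)\<close>. Then
  \<open>y n * e n\<close> is itself null.\<close>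

lemma tendsto_if_perturbed_fixpoint:
  fixes y :: "nat \<Rightarrow> 'a::real_normed_algebra_1"
  assumes y: "\<And>n. y n = l + y n * e n + d n" and e: "e \<longlonglongrightarrow> 0" and d: "d \<longlonglongrightarrow> 0"
  shows "y \<longlonglongrightarrow> l"
proof -
  have "eventually (\<lambda>n. norm (e n) < 1/2) sequentially"
    using tendstoD[OF e, of "1/2"] by (simp add: dist_norm)
  moreover have "eventually (\<lambda>n. norm (d n) < 1) sequentially"
    using tendstoD[OF d, of 1] by (simp add: dist_norm)
  ultimately have "eventually (\<lambda>n. norm (y n) \<le> 2 * norm l + 2) sequentially"
  proof eventually_elim
    case (elim n)
    have "norm (y n) \<le> norm l + norm (y n * e n) + norm (d n)"
      using arg_cong[OF y, of norm n] norm_triangle_ineq[of "l + y n * e n" "d n"]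
        norm_triangle_ineq[of l "y n * e n"]
      by linarith
    also have "norm (y n * e n) \<le> norm (y n) * (1/2)"
      using norm_mult_ineq[of "y n" "e n"] mult_left_mono[OF less_imp_le[OF elim(1)] norm_ge_zero[of "y n"]]
      by linarith
    finally show ?case
      using elim(2) by linarith
  qed
  then have "Bfun y sequentially"
    by (rule BfunI)
  then have "(\<lambda>n. y n * e n) \<longlonglongrightarrow> 0"
    using bounded_bilinear.Bfun_prod_Zfun[OF bounded_bilinear_mult] e
    by (simp add: tendsto_Zfun_iff)
  from tendsto_add[OF tendsto_add[OF tendsto_const[of l] this] d]
  show ?thesis
    using y by simp
qed

text \<open>From \<open>q * (1 - a * y) = 0\<close> and \<open>z * q' = z\<close>, the
  \<open>q\<close> term contributes \<open>z * (1 - a * y)\<close>. The \<open>a\<close> and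
  \<open>p\<close> terms together give \<open>z * a * y - p' * y\<close>, and
  \<open>y + (p' - p) * y = p' * y\<close> restores the rest. Each correction contains a difference
  of corresponding data.\<close>

lemma bc_inverse_diff:
  fixes y z :: "'a::ring_1"
  assumes "p * y = y" "q * a * y = q" and "z * q' = z" "z * a' * p' = p'"
  shows "z = y + z * ((a - a') * y + a' * (p - p') * y - (q - q') * (1 - a * y)) + (p' - p) * y"
proof -
  have "z * (a' * (p' * y)) = p' * y" "q * (a * y) = q" "z * (q' * x) = z * x" for x
    using assms by (simp_all flip: mult.assoc)
  then show ?thesis
    using assms(1,3) by (simp add: algebra_simps)
qed

section \<open>Equivalence of the eight conditions\<close>

theorem theorem5p4:
  fixes a b c :: "'a::complex_banach_algebra_1"
    and an bn cn :: "nat \<Rightarrow> 'a"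
  assumes "mp_invertible b" and "mp_invertible c"
    and "bc_invertible b c a" and "bc_inverse b c a \<noteq> 0"
    and "\<And>n. mp_invertible (bn n)" and "\<And>n. mp_invertible (cn n)"
    and "\<And>n. bc_invertible (bn n) (cn n) (an n)"
    and "an \<longlonglongrightarrow> a"
  shows "
     (((\<lambda>n. bc_inverse (bn n) (cn n) (an n)) \<longlonglongrightarrow> bc_inverse b c a) \<longleftrightarrow>
        ((\<lambda>n. bc_inverse (bn n) (cn n) (an n) * an n) \<longlonglongrightarrow> bc_inverse b c a * a) \<and>
        ((\<lambda>n. c\<^sup>\<dagger> * c * (1 - (cn n)\<^sup>\<dagger> * cn n)) \<longlonglongrightarrow> 0) \<and>
        ((\<lambda>n. (cn n)\<^sup>\<dagger> * cn n * (1 - c\<^sup>\<dagger> * c)) \<longlonglongrightarrow> 0)) \<and>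
     (((\<lambda>n. bc_inverse (bn n) (cn n) (an n)) \<longlonglongrightarrow> bc_inverse b c a) \<longleftrightarrow>
        ((\<lambda>n. an n * bc_inverse (bn n) (cn n) (an n)) \<longlonglongrightarrow> a * bc_inverse b c a) \<and>
        ((\<lambda>n. (1 - b * b\<^sup>\<dagger>) * bn n * (bn n)\<^sup>\<dagger>) \<longlonglongrightarrow> 0) \<and>
        ((\<lambda>n. (1 - bn n * (bn n)\<^sup>\<dagger>) * b * b\<^sup>\<dagger>) \<longlonglongrightarrow> 0)) \<and>
     (((\<lambda>n. bc_inverse (bn n) (cn n) (an n)) \<longlonglongrightarrow> bc_inverse b c a) \<longleftrightarrow>
        ((\<lambda>n. (1 - b * b\<^sup>\<dagger>) * bn n * (bn n)\<^sup>\<dagger>) \<longlonglongrightarrow> 0) \<and>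
        ((\<lambda>n. (1 - bn n * (bn n)\<^sup>\<dagger>) * b * b\<^sup>\<dagger>) \<longlonglongrightarrow> 0) \<and>
        ((\<lambda>n. c\<^sup>\<dagger> * c * (1 - (cn n)\<^sup>\<dagger> * cn n)) \<longlonglongrightarrow> 0) \<and>
        ((\<lambda>n. (cn n)\<^sup>\<dagger> * cn n * (1 - c\<^sup>\<dagger> * c)) \<longlonglongrightarrow> 0)) \<and>
     (((\<lambda>n. bc_inverse (bn n) (cn n) (an n)) \<longlonglongrightarrow> bc_inverse b c a) \<longleftrightarrow>
        ((\<lambda>n. an n * bc_inverse (bn n) (cn n) (an n)) \<longlonglongrightarrow> a * bc_inverse b c a) \<and>
        ((\<lambda>n. b * b\<^sup>\<dagger> * (1 - bn n * (bn n)\<^sup>\<dagger>)) \<longlonglongrightarrow> 0) \<and>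
        ((\<lambda>n. bn n * (bn n)\<^sup>\<dagger> * (1 - b * b\<^sup>\<dagger>)) \<longlonglongrightarrow> 0)) \<and>
     (((\<lambda>n. bc_inverse (bn n) (cn n) (an n)) \<longlonglongrightarrow> bc_inverse b c a) \<longleftrightarrow>
        ((\<lambda>n. bc_inverse (bn n) (cn n) (an n) * an n) \<longlonglongrightarrow> bc_inverse b c a * a) \<and>
        ((\<lambda>n. (1 - c\<^sup>\<dagger> * c) * (cn n)\<^sup>\<dagger> * cn n) \<longlonglongrightarrow> 0) \<and>
        ((\<lambda>n. (1 - (cn n)\<^sup>\<dagger> * cn n) * c\<^sup>\<dagger> * c) \<longlonglongrightarrow> 0)) \<and>
     (((\<lambda>n. bc_inverse (bn n) (cn n) (an n)) \<longlonglongrightarrow> bc_inverse b c a) \<longleftrightarrow>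
        ((\<lambda>n. b * b\<^sup>\<dagger> * (1 - bn n * (bn n)\<^sup>\<dagger>)) \<longlonglongrightarrow> 0) \<and>
        ((\<lambda>n. bn n * (bn n)\<^sup>\<dagger> * (1 - b * b\<^sup>\<dagger>)) \<longlonglongrightarrow> 0) \<and>
        ((\<lambda>n. (1 - c\<^sup>\<dagger> * c) * (cn n)\<^sup>\<dagger> * cn n) \<longlonglongrightarrow> 0) \<and>
        ((\<lambda>n. (1 - (cn n)\<^sup>\<dagger> * cn n) * c\<^sup>\<dagger> * c) \<longlonglongrightarrow> 0)) \<and>
     (((\<lambda>n. bc_inverse (bn n) (cn n) (an n)) \<longlonglongrightarrow> bc_inverse b c a) \<longleftrightarrow>
        ((\<lambda>n. bn n * (bn n)\<^sup>\<dagger>) \<longlonglongrightarrow> b * b\<^sup>\<dagger>) \<and>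
        ((\<lambda>n. (cn n)\<^sup>\<dagger> * cn n) \<longlonglongrightarrow> c\<^sup>\<dagger> * c))"
proof -
  define p q y where "p = b * b\<^sup>\<dagger>" and "q = c\<^sup>\<dagger> * c" and "y = bc_inverse b c a"
  define pn qn yn where "pn n = bn n * (bn n)\<^sup>\<dagger>" and "qn n = (cn n)\<^sup>\<dagger> * cn n"
    and "yn n = bc_inverse (bn n) (cn n) (an n)" for n
  interpret P: hermitian_idempotents p pn
    unfolding p_def pn_def by unfold_locales (rule mp_inverse_projections assms)+
  interpret Q: hermitian_idempotents q qn
    unfolding q_def qn_def by unfold_locales (rule mp_inverse_projections assms)+
  have y: "p * y = y" "y * q = y" "y * a * p = p" "q * (a * y) = q"
    using bc_inverse_absorb[OF assms(1,2,3)] unfolding p_def q_def y_def .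
  have yn: "pn n * yn n = yn n" "yn n * qn n = yn n" "yn n * an n * pn n = pn n"
    "qn n * (an n * yn n) = qn n" for n
    using bc_inverse_absorb[OF assms(5,6,7)] unfolding pn_def qn_def yn_def .
  have f: "(\<lambda>n. yn n * an n) \<longlonglongrightarrow> y * a" and g: "(\<lambda>n. an n * yn n) \<longlonglongrightarrow> a * y"
    if "yn \<longlonglongrightarrow> y"
    using that assms(8) by (auto intro!: tendsto_intros)
  have fP: "pn \<longlonglongrightarrow> p" if "(\<lambda>n. yn n * an n) \<longlonglongrightarrow> y * a"
    by (rule P.tendsto_if_same_right_ideals[OF _ _ _ _ that]) (use y yn in \<open>simp_all flip: mult.assoc\<close>)
  have gQ: "qn \<longlonglongrightarrow> q" if "(\<lambda>n. an n * yn n) \<longlonglongrightarrow> a * y"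
    by (rule Q.tendsto_if_same_left_ideals[OF _ _ _ _ that]) (use y yn in \<open>simp_all add: mult.assoc\<close>)
  have PQ: "yn \<longlonglongrightarrow> y" if P: "pn \<longlonglongrightarrow> p" and Q: "qn \<longlonglongrightarrow> q"
  proof (rule tendsto_if_perturbed_fixpoint)
    let ?e = "\<lambda>n. (a - an n) * y + an n * (p - pn n) * y - (q - qn n) * (1 - a * y)"
    show "yn n = y + yn n * ?e n + (pn n - p) * y" for n
      using y yn by (intro bc_inverse_diff) (simp_all add: mult.assoc)
    have "?e \<longlonglongrightarrow> (a - a) * y + a * (p - p) * y - (q - q) * (1 - a * y)"
      by (intro tendsto_intros assms(8) P Q)
    then show "?e \<longlonglongrightarrow> 0" by simp
    have "(\<lambda>n. (pn n - p) * y) \<longlonglongrightarrow> (p - p) * y"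
      by (intro tendsto_intros P)
    then show "(\<lambda>n. (pn n - p) * y) \<longlonglongrightarrow> 0" by simp
  qed
  \<comment> \<open>Products in the statement associate to the left, which hides the projections
    behind factors such as \<open>1 - p\<close>.\<close>
  have fold: "x * b * b\<^sup>\<dagger> = x * p" "x * c\<^sup>\<dagger> * c = x * q"
    "x * bn n * (bn n)\<^sup>\<dagger> = x * pn n" "x * (cn n)\<^sup>\<dagger> * cn n = x * qn n" for x n
    by (simp_all add: p_def q_def pn_def qn_def mult.assoc)
  \<comment> \<open>Each condition now pairs two of four limits: \<open>fP\<close> recovers
    \<open>p\<close> from \<open>y * a\<close>, \<open>gQ\<close> recovers \<open>q\<close> from
    \<open>a * y\<close>, and \<open>PQ\<close> concludes. Conjunctions nest to the right, so
    rewriting folds only trailing pairs; the equivalences passed to \<open>blast\<close> serve the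
    leading ones.\<close>
  show ?thesis
    unfolding fold
    unfolding p_def[symmetric] q_def[symmetric] y_def[symmetric]
      pn_def[symmetric] qn_def[symmetric] yn_def[symmetric]
      P.tendsto_iff_left[symmetric] P.tendsto_iff_right[symmetric]
      Q.tendsto_iff_left[symmetric] Q.tendsto_iff_right[symmetric]
    using f g fP gQ PQ P.tendsto_iff_left P.tendsto_iff_right Q.tendsto_iff_left Q.tendsto_iff_right
    by blast
qed

end
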